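(* Consider the network described in the context. Assume $K$ is large and $M$ is fixed. Then: (i) For moderate interference (i.e. $\mathbb{E}[I_i]=\Theta(1)$), the network average sum-rate is bounded by $\bar R_{ave}\le\Theta(\log n)$. (ii) For weak interference (i.e. $\mathbb{E}[I_i]=o(1)$), the network average sum-rate is bounded by $\bar R_{ave}\le o(\log n)$.
   Context: Network: $K$ transmitter-receiver links are partitioned into $M$ clusters $\mathbb{C}_j=\{(j-1)n+1,\dots,jn\}$, $j=1,\dots,M$, with $n=K/M$ an integer. Cluster $j$ uses its own orthogonal subchannel of bandwidth $W/M$ (there is no interference between clusters); $W$ is the total bandwidth and $N_0$ the noise power spectral density, both fixed. Channel gains: the gain from transmitter $k$ to receiver $i$ is $\mathcal{L}_{ki}$. For $k=i$, $\mathcal{L}_{ii}=h_{ii}$ is exponential with mean 1. For $k\ne i$, $\mathcal{L}_{ki}=\beta_{ki}h_{ki}$ with probability $\alpha$ and $\mathcal{L}_{ki}=0$ with probability $1-\alpha$, where $0\le\alpha\le1$ is a fixed parameter, $h_{ki}$ is exponential with mean 1, and $\beta_{ki}$ is independent of $h_{ki}$ with $\beta_{\min}\le\beta_{ki}\le\beta_{\max}$, $\beta_{\min}>0$, $\beta_{\max}$ finite, and $\mathbb{E}[\beta_{ki}]=\varpi\le 1$. The gains are mutually independent for different $(k,i)$, and the cross gains $\mathcal{L}_{ki}$, $k\neq i$, have the same distribution. Powers and rates: user $i$ knows only its direct gain $h_{ii}$; all users use the same power allocation policy $p_i=g(h_{ii})\in[0,1]$. For $i\in\mathbb{C}_j$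 the interference is $I_i=\sum_{k\in\mathbb{C}_j,k\ne i}\mathcal{L}_{ki}p_k$, and the rate is $R_i=\frac{W}{M}\log\left(1+\frac{h_{ii}p_i}{I_i+N_0W/M}\right)$ ($\log$ natural). The network average sum-rate is $\bar R_{ave}=\mathbb{E}\left[\sum_{j=1}^M\sum_{l\in\mathbb{C}_j}R_l\right]$. Notation (as $K\to\infty$, equivalently $n\to\infty$): $f=\Theta(g)$ means $\lim f/g=c$ with $0<c<\infty$; $f=o(g)$ means $\lim|f/g|=0$. The inequality $\bar R_{ave}\le\Theta(\log n)$ (resp. $\le o(\log n)$) means that $\bar R_{ave}$ is bounded above by some function that is $\Theta(\log n)$ (resp. $o(\log n)$).
   Formalization: Part (ii) additionally assumes α > 0: for α = 0 there is no interference, so E[I_i] = 0 = o(1) for every policy, yet full power g = 1 gives a sum-rate linear in n, which contradicts the claimed o(log n) bound. *)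

theory Defs
  imports "HOL-Probability.Probability" "HOL-Library.Landau_Symbols"
begin

(* f = Theta(g) is meant in the sense that f/g has a finite positive limit.  This is stronger than
   membership in the two-sided Landau class bigtheta.  For little-o, the library notion is
   equivalent to lim |f/g| = 0 whenever g is eventually nonzero, and is used as it is. *)
definition lim_theta :: "(nat \<Rightarrow> real) \<Rightarrow> (nat \<Rightarrow> real) \<Rightarrow> bool" where
  "lim_theta f g \<longleftrightarrow> (\<exists>c>0. (\<lambda>n. f n / g n) \<longlonglongrightarrow> c)"

definition cluster :: "nat \<Rightarrow> nat \<Rightarrow> nat set" where
  "cluster n j = {(j - 1) * n + 1 .. j * n}"

(* Gain from transmitter k to receiver i.  S k i is the event, of probability \<alpha>, that the
   cross link is present. *)
definition gain ::
  "(nat \<Rightarrow> nat \<Rightarrow> 'a \<Rightarrow> bool) \<Rightarrow> (nat \<Rightarrow> nat \<Rightarrow> 'a \<Rightarrow> real) \<Rightarrow> (nat \<Rightarrow> nat \<Rightarrow> 'a \<Rightarrow> real)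
    \<Rightarrow> nat \<Rightarrow> nat \<Rightarrow> 'a \<Rightarrow> real" where
  "gain S \<beta> h k i \<omega> =
     (if k = i then h i i \<omega> else if S k i \<omega> then \<beta> k i \<omega> * h k i \<omega> else 0)"

(* In the next three definitions L is the matrix of gains, g the power allocation policy and
   j the cluster of user i. *)
definition interference ::
  "nat \<Rightarrow> (nat \<Rightarrow> nat \<Rightarrow> 'a \<Rightarrow> real) \<Rightarrow> (real \<Rightarrow> real) \<Rightarrow> nat \<Rightarrow> nat \<Rightarrow> 'a \<Rightarrow> real" where
  "interference n L g j i \<omega> = (\<Sum>k \<in> cluster n j - {i}. L k i \<omega> * g (L k k \<omega>))"

definition rate ::
  "nat \<Rightarrow> nat \<Rightarrow> real \<Rightarrow> real \<Rightarrow> (nat \<Rightarrow> nat \<Rightarrow> 'a \<Rightarrow> real) \<Rightarrow> (real \<Rightarrow> real) \<Rightarrow> nat \<Rightarrow> nat \<Rightarrow> 'a \<Rightarrow> real" where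
  "rate M n W N0 L g j i \<omega> =
     W / real M *
       ln (1 + L i i \<omega> * g (L i i \<omega>) / (interference n L g j i \<omega> + N0 * W / real M))"

definition avg_sum_rate ::
  "'a measure \<Rightarrow> nat \<Rightarrow> nat \<Rightarrow> real \<Rightarrow> real \<Rightarrow> (nat \<Rightarrow> nat \<Rightarrow> 'a \<Rightarrow> real) \<Rightarrow> (real \<Rightarrow> real) \<Rightarrow> real" where
  "avg_sum_rate P M n W N0 L g =
     (\<integral>\<omega>. (\<Sum>j=1..M. \<Sum>l\<in>cluster n j. rate M n W N0 L g j l \<omega>) \<partial>P)"

(* M clusters of n links each.  Within a cross link, presence is independent of the pair of
   shadowing \<beta> and fading h, so the gain has law \<alpha> * law(\<beta> h) + (1 - \<alpha>) * \<delta>_0. *)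
locale clustered_network = prob_space P
  for P :: "'a measure" +
  fixes M n :: nat
    and \<alpha> \<beta>min \<beta>max varpi :: real
    and S :: "nat \<Rightarrow> nat \<Rightarrow> 'a \<Rightarrow> bool"
    and \<beta> h :: "nat \<Rightarrow> nat \<Rightarrow> 'a \<Rightarrow> real"
    and g :: "real \<Rightarrow> real"
  assumes alpha: "0 \<le> \<alpha>" "\<alpha> \<le> 1"
    and beta_min_pos: "0 < \<beta>min"
    and varpi_le: "varpi \<le> 1"
    and fading: "\<And>k i. k \<in> {1..M * n} \<Longrightarrow> i \<in> {1..M * n} \<Longrightarrow>
        distributed P lborel (h k i) (exponential_density 1)"
    and shadowing_measurable: "\<And>k i. k \<in> {1..M * n} \<Longrightarrow> i \<in> {1..M * n} \<Longrightarrow> k \<noteq> i \<Longrightarrow>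
        \<beta> k i \<in> borel_measurable P"
    and shadowing_bounds: "\<And>k i. k \<in> {1..M * n} \<Longrightarrow> i \<in> {1..M * n} \<Longrightarrow> k \<noteq> i \<Longrightarrow>
        AE \<omega> in P. \<beta>min \<le> \<beta> k i \<omega> \<and> \<beta> k i \<omega> \<le> \<beta>max"
    and shadowing_mean: "\<And>k i. k \<in> {1..M * n} \<Longrightarrow> i \<in> {1..M * n} \<Longrightarrow> k \<noteq> i \<Longrightarrow>
        expectation (\<beta> k i) = varpi"
    and shadowing_indep_fading: "\<And>k i. k \<in> {1..M * n} \<Longrightarrow> i \<in> {1..M * n} \<Longrightarrow> k \<noteq> i \<Longrightarrow>
        indep_var borel (\<beta> k i) borel (h k i)"
    and presence_prob: "\<And>k i. k \<in> {1..M * n} \<Longrightarrow> i \<in> {1..M * n} \<Longrightarrow> k \<noteq> i \<Longrightarrow>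
        prob {\<omega> \<in> space P. S k i \<omega>} = \<alpha>"
    and presence_indep: "\<And>k i A. k \<in> {1..M * n} \<Longrightarrow> i \<in> {1..M * n} \<Longrightarrow> k \<noteq> i \<Longrightarrow>
        A \<in> sets (borel \<Otimes>\<^sub>M borel) \<Longrightarrow>
        indep_event {\<omega> \<in> space P. S k i \<omega>} {\<omega> \<in> space P. (\<beta> k i \<omega>, h k i \<omega>) \<in> A}"
    and gains_indep:
        "indep_vars (\<lambda>_. borel) (\<lambda>(k, i). gain S \<beta> h k i) ({1..M * n} \<times> {1..M * n})"
    and cross_gains_same_distr: "\<And>k i k' i'. k \<in> {1..M * n} \<Longrightarrow> i \<in> {1..M * n} \<Longrightarrow> k \<noteq> i \<Longrightarrow>
        k' \<in> {1..M * n} \<Longrightarrow> i' \<in> {1..M * n} \<Longrightarrow> k' \<noteq> i' \<Longrightarrow>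
        distr P borel (gain S \<beta> h k i) = distr P borel (gain S \<beta> h k' i')"
    and policy_measurable: "g \<in> borel_measurable borel"
    and policy_range: "\<And>x. 0 \<le> x \<Longrightarrow> 0 \<le> g x \<and> g x \<le> 1"

end

(* By ln (1 + x) <= x and nonnegativity of the interference, a user contributes at most E[h g(h)] / N0
   to the average sum-rate. Splitting h <= t + max 0 (h - t) gives E[h g(h)] <= t q + exp (- t) with
   q = E[g(h)]; the choice t = ln n bounds the sum-rate by M / N0 (n q ln n + 1). The
   interference at a user has mean (n - 1) \<alpha> varpi q, so its size controls the limit of n q. *)

theory Submission
  imports Defs "HOL-Real_Asymp.Real_Asymp"
begin

section \<open>Exponential variables: integrability, sign and excess over a level\<close>

lemma (in prob_space) exponential_integrable:
  assumes "0 < l" "distributed M lborel X (exponential_density l)"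
  shows "integrable M X"
  \<comment> \<open>A nonintegrable function has integral 0 by convention, whereas the mean here is
    \<open>1 / l\<close>, which is positive.\<close>
  using exponential_distributed_expectation[OF assms] assms(1) not_integrable_integral_eq by force

lemma (in prob_space) exponential_AE_nonneg:
  assumes "0 < l" "distributed M lborel X (exponential_density l)"
  shows "AE \<omega> in M. 0 \<le> X \<omega>"
proof -
  have X [measurable]: "X \<in> borel_measurable M"
    using assms exponential_distributed_iff by blast
  have "prob {\<omega> \<in> space M. 0 < X \<omega>} = 1"
    using exponential_distributedD_gt[OF assms(2) _ assms(1), of 0] by simp
  then have "AE \<omega> in M. 0 < X \<omega>"
    by (intro AE_prob_1[THEN eventually_mono, of "{\<omega> \<in> space M. 0 < X \<omega>}"]) auto
  then show ?thesis
    by eventually_elim simp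
qed

text \<open>Memorylessness: given that the variable exceeds \<open>t\<close>, which has probability
  \<open>exp (- t)\<close>, the excess is again exponential with mean 1.\<close>

lemma (in prob_space) exponential_excess:
  assumes D: "distributed M lborel X (exponential_density 1)" and t: "0 \<le> t"
  shows "expectation (\<lambda>\<omega>. max 0 (X \<omega> - t)) = exp (- t)"
proof -
  let ?d = "exponential_density 1"
  have nonneg: "0 \<le> ?d x" for x
    by (simp add: exponential_density_nonneg)
  have "expectation (\<lambda>\<omega>. max 0 (X \<omega> - t)) = (\<integral>x. ?d x * max 0 (x - t) \<partial>lborel)"
    by (subst distributed_integral[OF D]) (auto simp: nonneg)
  also have "\<dots> = (\<integral>x. ?d (t + x) * max 0 x \<partial>lborel)"
    by (subst lborel_integral_real_affine[where c=1 and t=t]) auto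
  \<comment> \<open>For negative \<open>x\<close> both integrands vanish, the left one through the
    maximum and the right one through the density; elsewhere the density factorizes.\<close>
  also have "\<dots> = (\<integral>x. exp (- t) * (?d x * x) \<partial>lborel)"
    using t by (intro Bochner_Integration.integral_cong refl)
      (auto simp: exponential_density_def exp_diff exp_minus field_simps exp_add)
  also have "\<dots> = exp (- t) * expectation X"
    using distributed_integral[OF D, of "\<lambda>x. x"] by (simp add: nonneg)
  also have "\<dots> = exp (- t)"
    using exponential_distributed_expectation[OF _ D] by simp
  finally show ?thesis .
qed

context prob_space
begin

section \<open>A power policy applied to one exponential gain\<close>

context
  fixes X :: "'a \<Rightarrow> real" and g :: "real \<Rightarrow> real"
  assumes D: "distributed M lborel X (exponential_density 1)"
    and g [measurable]: "g \<in> borel_measurable borel"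
    and g_range: "\<And>x. 0 \<le> x \<Longrightarrow> 0 \<le> g x \<and> g x \<le> 1"
begin

lemma exponential_policy_range: "AE \<omega> in M. 0 \<le> X \<omega> \<and> 0 \<le> g (X \<omega>) \<and> g (X \<omega>) \<le> 1"
  using exponential_AE_nonneg[OF zero_less_one D] by eventually_elim (use g_range in auto)

lemma exponential_policy_integrable:
  shows "integrable M (\<lambda>\<omega>. g (X \<omega>))" and "integrable M (\<lambda>\<omega>. X \<omega> * g (X \<omega>))"
proof -
  have X [measurable]: "X \<in> borel_measurable M"
    using D exponential_distributed_iff zero_less_one by blast
  show "integrable M (\<lambda>\<omega>. g (X \<omega>))"
    by (rule integrable_const_bound[of _ 1]) (use exponential_policy_range in auto)
  show "integrable M (\<lambda>\<omega>. X \<omega> * g (X \<omega>))"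
  proof (rule Bochner_Integration.integrable_bound[OF exponential_integrable[OF _ D]])
    show "AE \<omega> in M. norm (X \<omega> * g (X \<omega>)) \<le> norm (X \<omega>)"
      using exponential_policy_range by eventually_elim (auto simp: abs_mult mult_left_le)
  qed auto
qed

lemma exponential_policy_mean:
  "expectation (\<lambda>\<omega>. g (X \<omega>)) = (\<integral>x. exponential_density 1 x * g x \<partial>lborel)"
  by (subst distributed_integral[OF D]) (auto simp: exponential_density_nonneg)

text \<open>For a given mean power the worst policies are thresholds; the threshold \<open>t\<close> appears as
  the Lagrange multiplier of the mean power.\<close>
lemma exponential_policy_bound:
  assumes t: "0 \<le> t"
  shows "expectation (\<lambda>\<omega>. X \<omega> * g (X \<omega>)) \<le> t * expectation (\<lambda>\<omega>. g (X \<omega>)) + exp (- t)"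
proof -
  have int: "integrable M (\<lambda>\<omega>. max 0 (X \<omega> - t))"
    using exponential_integrable[OF _ D] by simp
  have "expectation (\<lambda>\<omega>. X \<omega> * g (X \<omega>)) \<le> expectation (\<lambda>\<omega>. t * g (X \<omega>) + max 0 (X \<omega> - t))"
  proof (rule integral_mono_AE)
    show "AE \<omega> in M. X \<omega> * g (X \<omega>) \<le> t * g (X \<omega>) + max 0 (X \<omega> - t)"
      using exponential_policy_range
    proof eventually_elim
      case (elim \<omega>)
      then have "(X \<omega> - t) * g (X \<omega>) \<le> max 0 (X \<omega> - t) * g (X \<omega>)"
        by (intro mult_right_mono) auto
      also have "\<dots> \<le> max 0 (X \<omega> - t)"
        using elim by (intro mult_left_le) auto
      finally show ?case
        by (simp add: algebra_simps)
    qed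
  qed (use exponential_policy_integrable int in auto)
  also have "\<dots> = t * expectation (\<lambda>\<omega>. g (X \<omega>)) + exp (- t)"
    using exponential_policy_integrable int exponential_excess[OF D t] by simp
  finally show ?thesis .
qed

end

section \<open>Independence of pairs and of indicators\<close>

lemma indep_vars_pair:
  assumes ind: "indep_vars M' X I" and ab: "a \<in> I" "b \<in> I" "a \<noteq> b"
  shows "indep_var (M' a) (X a) (M' b) (X b)"
proof -
  \<comment> \<open>Disjoint blocks of an independent family are independent. Here the blocks are
    singletons, and evaluation at the index recovers the variable.\<close>
  have "indep_var (M' a) ((\<lambda>f. f a) \<circ> (\<lambda>\<omega>. restrict (\<lambda>i. X i \<omega>) {a}))
      (M' b) ((\<lambda>f. f b) \<circ> (\<lambda>\<omega>. restrict (\<lambda>i. X i \<omega>) {b}))"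
    using ab by (intro indep_var_compose[OF indep_var_restrict[OF ind]]) auto
  then show ?thesis
    by (simp add: comp_def)
qed

text \<open>Turns independence of events into a form in which expectations of products factorize.
  Both \<open>{A}\<close> and the preimages under \<open>Y\<close> are stable under intersection, so
  independence extends to the sigma-algebras they generate, and the indicator is measurable for the
  first.\<close>

lemma indep_var_indicator:
  assumes ind: "\<And>B. B \<in> sets N \<Longrightarrow> indep_event A (Y -` B \<inter> space M)"
    and Y: "Y \<in> measurable M N"
  shows "indep_var borel (indicator A :: 'a \<Rightarrow> real) N Y"
proof -
  have AB: "A \<in> events" "prob (A \<inter> (Y -` B \<inter> space M)) = prob A * prob (Y -` B \<inter> space M)"
    if "B \<in> sets N" for B
  proof -
    have *: "indep_set {A} {Y -` B \<inter> space M}"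
      using ind[OF that] unfolding indep_event_def indep_events_def_alt indep_set_def
      by (rule indep_sets_mono_sets) (auto split: bool.split)
    show "A \<in> events" "prob (A \<inter> (Y -` B \<inter> space M)) = prob A * prob (Y -` B \<inter> space M)"
      using * unfolding indep_sets2_eq by auto
  qed
  have A: "A \<in> events"
    \<comment> \<open>Independence of two events includes their measurability, so any
      \<open>B\<close> will do.\<close>
    using AB(1)[of "{}"] by simp
  let ?F = "{Y -` B \<inter> space M | B. B \<in> sets N}"
  have "indep_set {A} ?F"
    using A AB(2) Y by (intro indep_setI) (auto intro: measurable_sets)
  moreover have "Int_stable ?F"
  proof (rule Int_stableI)
    fix a b assume "a \<in> ?F" "b \<in> ?F"
    then obtain B C where "a = Y -` B \<inter> space M" "b = Y -` C \<inter> space M" "B \<in> sets N" "C \<in> sets N"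
      by blast
    then show "a \<inter> b \<in> ?F"
      by (intro CollectI exI[of _ "B \<inter> C"]) auto
  qed
  ultimately have S: "indep_set (sigma_sets (space M) {A}) (sigma_sets (space M) ?F)"
    by (intro indep_set_sigma_sets) (auto simp: Int_stable_def)
  have "indicator A -` B \<inter> space M \<in> sigma_sets (space M) {A}" for B :: "real set"
  proof -
    have "A \<subseteq> space M"
      using A sets.sets_into_space by auto
    \<comment> \<open>Only the values 0 and 1 occur, so the preimage depends on which of them lie in
      \<open>B\<close>.\<close>
    have "indicator A -` B \<inter> space M =
      (if 1 \<in> B then A else {}) \<union> (if 0 \<in> B then space M - A else {})"
      using \<open>A \<subseteq> space M\<close> by (auto simp: indicator_def of_bool_def split: if_splits)
    also have "\<dots> \<in> sigma_sets (space M) {A}"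
      by (intro sigma_sets_Un) (auto intro: sigma_sets.intros)
    finally show ?thesis .
  qed
  then have "sigma_sets (space M) {(indicator A :: 'a \<Rightarrow> real) -` B \<inter> space M | B. B \<in> sets borel}
    \<subseteq> sigma_sets (space M) {A}"
    by (intro sigma_sets_mono) auto
  with S have "indep_set (sigma_sets (space M) {(indicator A :: 'a \<Rightarrow> real) -` B \<inter> space M | B. B \<in> sets borel})
     (sigma_sets (space M) ?F)"
    unfolding indep_sets2_eq by blast
  then show ?thesis
    unfolding indep_var_eq using A Y by auto
qed

end

section \<open>Clusters and direct links of the network\<close>

context clustered_network
begin

abbreviation "L \<equiv> gain S \<beta> h"

text \<open>Integrating against the density makes the mean power depend on \<open>g\<close> alone,
  without reference to a user or to the probability space.\<close>

definition "mean_power = (\<integral>x. exponential_density 1 x * g x \<partial>lborel)"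

lemma direct_gain: "L k k = h k k"
  by (simp add: gain_def fun_eq_iff)

lemma cluster_subset: "j \<in> {1..M} \<Longrightarrow> cluster n j \<subseteq> {1..M * n}"
proof -
  assume "j \<in> {1..M}"
  then have "j * n \<le> M * n"
    by simp
  then show ?thesis
    unfolding cluster_def by (auto intro: order_trans)
qed

text \<open>The index starts at 1: for \<open>j = 0\<close> truncated subtraction makes the set
  empty.\<close>

lemma card_cluster: "1 \<le> j \<Longrightarrow> card (cluster n j) = n"
  by (cases j) (simp_all add: cluster_def)

lemma fading_moments:
  assumes "k \<in> {1..M * n}" "i \<in> {1..M * n}"
  shows "integrable P (h k i)" "expectation (h k i) = 1" "AE \<omega> in P. 0 \<le> h k i \<omega>"
  using exponential_integrable[OF _ fading[OF assms]]
    exponential_distributed_expectation[OF _ fading[OF assms]]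
    exponential_AE_nonneg[OF _ fading[OF assms]] by simp_all

text \<open>All direct gains have the same exponential law and share the policy, so the
  single-variable results hold with one mean power for all users.\<close>

lemma direct_link_policy:
  assumes "k \<in> {1..M * n}"
  shows "AE \<omega> in P. 0 \<le> h k k \<omega> \<and> 0 \<le> g (h k k \<omega>) \<and> g (h k k \<omega>) \<le> 1"
    and "integrable P (\<lambda>\<omega>. g (h k k \<omega>))"
    and "integrable P (\<lambda>\<omega>. h k k \<omega> * g (h k k \<omega>))"
    and "expectation (\<lambda>\<omega>. g (h k k \<omega>)) = mean_power"
    and "0 \<le> t \<Longrightarrow> expectation (\<lambda>\<omega>. h k k \<omega> * g (h k k \<omega>)) \<le> t * mean_power + exp (- t)"
proof -
  note D = fading[OF assms assms]
  show "AE \<omega> in P. 0 \<le> h k k \<omega> \<and> 0 \<le> g (h k k \<omega>) \<and> g (h k k \<omega>) \<le> 1"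
    using D policy_measurable policy_range by (rule exponential_policy_range)
  show "integrable P (\<lambda>\<omega>. g (h k k \<omega>))" "integrable P (\<lambda>\<omega>. h k k \<omega> * g (h k k \<omega>))"
    using exponential_policy_integrable[OF D policy_measurable policy_range] by auto
  show mean: "expectation (\<lambda>\<omega>. g (h k k \<omega>)) = mean_power"
    unfolding mean_power_def using D policy_measurable policy_range by (rule exponential_policy_mean)
  show "expectation (\<lambda>\<omega>. h k k \<omega> * g (h k k \<omega>)) \<le> t * mean_power + exp (- t)" if "0 \<le> t"
    unfolding mean[symmetric] using D policy_measurable policy_range that
    by (rule exponential_policy_bound)
qed

section \<open>Cross gains and single interference terms\<close>

context
  fixes k i assumes ki: "k \<in> {1..M * n}" "i \<in> {1..M * n}" "k \<noteq> i"
begin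

lemma shadowing_nonneg: "AE \<omega> in P. 0 \<le> \<beta> k i \<omega>"
  using shadowing_bounds[OF ki] by eventually_elim (use beta_min_pos in linarith)

lemma shadowing_integrable: "integrable P (\<beta> k i)"
  by (rule integrable_const_bound[of _ "\<beta>max"])
    (use shadowing_bounds[OF ki] beta_min_pos shadowing_measurable[OF ki] in auto)

text \<open>The mean is at least the almost sure lower bound \<open>\<beta>min\<close>. Positivity
  allows the later division by \<open>\<alpha> * varpi\<close>.\<close>

lemma varpi_pos: "0 < varpi"
proof -
  have "expectation (\<lambda>_. \<beta>min) \<le> expectation (\<beta> k i)"
    using shadowing_bounds[OF ki] shadowing_integrable by (intro integral_mono_AE) auto
  then show ?thesis
    using beta_min_pos shadowing_mean[OF ki] by (simp add: prob_space)
qed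

lemma cross_gain_nonneg: "AE \<omega> in P. 0 \<le> L k i \<omega>"
  using shadowing_nonneg fading_moments(3)[OF ki(1,2)] ki(3)
  by (auto simp: gain_def)

text \<open>The gain is the presence indicator times shadowing times fading. Presence is independent
  of the product of the other two, which are independent of each other, so the means
  multiply.\<close>

lemma cross_gain_mean: "integrable P (L k i)" "expectation (L k i) = \<alpha> * varpi"
proof -
  let ?A = "{\<omega> \<in> space P. S k i \<omega>}"
  have [measurable]: "\<beta> k i \<in> borel_measurable P" "h k i \<in> borel_measurable P"
    using shadowing_measurable[OF ki] fading_moments(1)[OF ki(1,2)] by auto
  have ind: "indep_var borel (indicator ?A :: 'a \<Rightarrow> real) borel (\<lambda>\<omega>. \<beta> k i \<omega> * h k i \<omega>)"
  proof (rule indep_var_indicator)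
    fix B :: "real set" assume [measurable]: "B \<in> sets borel"
    \<comment> \<open>\<open>presence_indep\<close> speaks of events of the pair; an event of the
      product is one, by pulling \<open>B\<close> back under multiplication.\<close>
    have "(\<lambda>p. fst p * snd p) -` B \<inter> space (borel \<Otimes>\<^sub>M borel) \<in> sets (borel \<Otimes>\<^sub>M borel)"
      by measurable
    from presence_indep[OF ki this]
    show "indep_event ?A ((\<lambda>\<omega>. \<beta> k i \<omega> * h k i \<omega>) -` B \<inter> space P)"
      by (simp add: space_pair_measure vimage_def Int_def conj_commute)
  qed simp
  have A: "integrable P (indicator ?A :: 'a \<Rightarrow> real)"
    using indep_var_rv1[OF ind] by (intro integrable_const_bound[of _ 1]) auto
  \<comment> \<open>Measurability of the presence event is read off from integrability of its
    indicator.\<close>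
  then have "?A \<in> events"
    by (simp add: integrable_indicator_iff Int_absorb2 subset_eq)
  then have EA: "expectation (indicator ?A) = \<alpha>"
    using presence_prob[OF ki] by simp
  note \<beta>h = shadowing_indep_fading[OF ki] shadowing_integrable fading_moments(1)[OF ki(1,2)]
  note prod = ind A indep_var_integrable[OF \<beta>h]
  have "integrable P (L k i) \<longleftrightarrow> integrable P (\<lambda>\<omega>. indicator ?A \<omega> * (\<beta> k i \<omega> * h k i \<omega>))"
    by (rule Bochner_Integration.integrable_cong) (use ki(3) in \<open>auto simp: gain_def indicator_def\<close>)
  then show "integrable P (L k i)"
    using indep_var_integrable[OF prod] by simp
  have "expectation (L k i) = expectation (\<lambda>\<omega>. indicator ?A \<omega> * (\<beta> k i \<omega> * h k i \<omega>))"
    by (rule Bochner_Integration.integral_cong) (use ki(3) in \<open>auto simp: gain_def indicator_def\<close>)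
  also have "\<dots> = \<alpha> * varpi"
    using indep_var_lebesgue_integral[OF prod] indep_var_lebesgue_integral[OF \<beta>h]
      EA shadowing_mean[OF ki] fading_moments(2)[OF ki(1,2)] by simp
  finally show "expectation (L k i) = \<alpha> * varpi" .
qed

text \<open>The power of transmitter \<open>k\<close> is a function of its direct gain, a different
  entry of the gain matrix than the cross gain; the two factors are thus independent.\<close>

lemma interference_term:
  "integrable P (\<lambda>\<omega>. L k i \<omega> * g (L k k \<omega>))"
  "expectation (\<lambda>\<omega>. L k i \<omega> * g (L k k \<omega>)) = \<alpha> * varpi * mean_power"
  "AE \<omega> in P. 0 \<le> L k i \<omega> * g (L k k \<omega>)"
proof -
  note facts = direct_link_policy[OF ki(1)]
  have "indep_var borel (L k i) borel (L k k)"
    using indep_vars_pair[OF gains_indep, of "(k, i)" "(k, k)"] ki by simp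
  from indep_var_compose[OF this, of id borel g borel]
  have ind: "indep_var borel (L k i) borel (\<lambda>\<omega>. g (h k k \<omega>))"
    using policy_measurable by (simp add: comp_def direct_gain)
  note prod = ind cross_gain_mean(1) facts(2)
  show "integrable P (\<lambda>\<omega>. L k i \<omega> * g (L k k \<omega>))"
    using indep_var_integrable[OF prod] by (simp add: direct_gain)
  show "expectation (\<lambda>\<omega>. L k i \<omega> * g (L k k \<omega>)) = \<alpha> * varpi * mean_power"
    using indep_var_lebesgue_integral[OF prod] facts(4) cross_gain_mean(2)
    by (simp add: direct_gain)
  show "AE \<omega> in P. 0 \<le> L k i \<omega> * g (L k k \<omega>)"
    using cross_gain_nonneg facts(1) by eventually_elim (simp add: direct_gain)
qed

end

section \<open>Interference and rate of a single user\<close>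

context
  fixes j i assumes ji: "j \<in> {1..M}" "i \<in> cluster n j"
begin

lemma user_in_network: "i \<in> {1..M * n}" "k \<in> cluster n j \<Longrightarrow> k \<in> {1..M * n}"
  using ji cluster_subset by blast+

text \<open>By linearity, each other user of the cluster contributes the same mean. The value is the
  same for all \<open>j\<close> and \<open>i\<close>, so knowing it at one user controls the whole
  network.\<close>

lemma interference_mean:
  "expectation (interference n L g j i) = (real n - 1) * (\<alpha> * varpi * mean_power)"
proof -
  have "expectation (interference n L g j i) =
      (\<Sum>k\<in>cluster n j - {i}. expectation (\<lambda>\<omega>. L k i \<omega> * g (L k k \<omega>)))"
    unfolding interference_def using user_in_network
    by (intro Bochner_Integration.integral_sum interference_term(1)) auto
  also have "\<dots> = (\<Sum>k\<in>cluster n j - {i}. \<alpha> * varpi * mean_power)"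
    using user_in_network by (intro sum.cong refl interference_term(2)) auto
  \<comment> \<open>The cluster contains \<open>i\<close>, so \<open>n\<close> is at least 1 and
    natural subtraction agrees with real subtraction.\<close>
  also have "real (card (cluster n j - {i})) = real n - 1"
    using ji card_cluster[of j] card_gt_0_iff[of "cluster n j"]
    by (auto simp: cluster_def of_nat_diff)
  then have "(\<Sum>k\<in>cluster n j - {i}. \<alpha> * varpi * mean_power) = (real n - 1) * (\<alpha> * varpi * mean_power)"
    by simp
  finally show ?thesis .
qed

lemma interference_nonneg: "AE \<omega> in P. 0 \<le> interference n L g j i \<omega>"
proof -
  have "AE \<omega> in P. \<forall>k\<in>cluster n j - {i}. 0 \<le> L k i \<omega> * g (L k k \<omega>)"
    using user_in_network interference_term(3)
    by (intro AE_finite_allI) (auto simp: cluster_def)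
  then show ?thesis
    by eventually_elim (auto simp: interference_def intro!: sum_nonneg)
qed

text \<open>Once the logarithm is linearized and the interference dropped, the prefactor
  \<open>W / real M\<close> cancels against the noise power, leaving only \<open>N0\<close>.\<close>

lemma rate_le:
  assumes "0 < W" "0 < N0"
  shows "AE \<omega> in P. rate M n W N0 L g j i \<omega> \<le> h i i \<omega> * g (h i i \<omega>) / N0"
proof -
  have "0 < M" using ji by simp
  show ?thesis
    using interference_nonneg direct_link_policy(1)[OF user_in_network(1)]
  proof eventually_elim
    case (elim \<omega>)
    let ?x = "h i i \<omega> * g (h i i \<omega>)" and ?I = "interference n L g j i \<omega>"
    have x: "0 \<le> ?x" using elim by simp
    have N: "0 < N0 * W / real M" using assms \<open>0 < M\<close> by simp
    have "ln (1 + ?x / (?I + N0 * W / real M)) \<le> ?x / (?I + N0 * W / real M)"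
      using x N elim by (intro ln_add_one_self_le_self) simp
    also have "\<dots> \<le> ?x / (N0 * W / real M)"
      using x N elim by (intro divide_left_mono mult_pos_pos) auto
    finally have "rate M n W N0 L g j i \<omega> \<le> W / real M * (?x / (N0 * W / real M))"
      unfolding rate_def direct_gain using assms by (intro mult_left_mono) auto
    also have "\<dots> = ?x / N0"
      using assms \<open>0 < M\<close> by simp
    finally show ?case .
  qed
qed

end

text \<open>At level \<open>ln (real n)\<close> the tail term of each user is \<open>1 / n\<close>,
  so the tails of one cluster add up to 1.\<close>

lemma avg_sum_rate_le:
  assumes "0 < W" "0 < N0" "1 \<le> n"
  shows "avg_sum_rate P M n W N0 L g \<le> real M / N0 * (real n * mean_power * ln (real n) + 1)"
proof -
  let ?f = "\<lambda>\<omega>. \<Sum>j=1..M. \<Sum>l\<in>cluster n j. h l l \<omega> * g (h l l \<omega>) / N0"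
  have users: "l \<in> {1..M * n}" if "j \<in> {1..M}" "l \<in> cluster n j" for j l
    using cluster_subset[of j] that by auto
  note facts = direct_link_policy[OF users]
  have fin: "finite (cluster n j)" for j by (simp add: cluster_def)
  have "avg_sum_rate P M n W N0 L g \<le> expectation ?f"
    unfolding avg_sum_rate_def
  \<comment> \<open>Only the upper bound has to be integrable: a nonintegrable sum-rate would have
    integral 0, which lies below the integral of the nonnegative bound.\<close>
  proof (rule integral_mono_AE')
    show "integrable P ?f"
      using facts(3) by auto
    have "AE \<omega> in P. \<forall>j\<in>{1..M}. \<forall>l\<in>cluster n j.
        rate M n W N0 L g j l \<omega> \<le> h l l \<omega> * g (h l l \<omega>) / N0"
      using rate_le assms by (intro AE_finite_allI fin) auto
    then show "AE \<omega> in P. (\<Sum>j=1..M. \<Sum>l\<in>cluster n j. rate M n W N0 L g j l \<omega>) \<le> ?f \<omega>"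
      by eventually_elim (auto intro!: sum_mono)
    have "AE \<omega> in P. \<forall>j\<in>{1..M}. \<forall>l\<in>cluster n j. 0 \<le> h l l \<omega> * g (h l l \<omega>) / N0"
    proof (intro AE_finite_allI fin)
      fix j l assume "j \<in> {1..M}" "l \<in> cluster n j"
      from facts(1)[OF this] show "AE \<omega> in P. 0 \<le> h l l \<omega> * g (h l l \<omega>) / N0"
        by eventually_elim (use assms in auto)
    qed simp
    then show "AE \<omega> in P. 0 \<le> ?f \<omega>"
      by eventually_elim (auto intro!: sum_nonneg)
  qed
  also have "expectation ?f = (\<Sum>j=1..M. \<Sum>l\<in>cluster n j. expectation (\<lambda>\<omega>. h l l \<omega> * g (h l l \<omega>)) / N0)"
    using facts(3) by (simp add: Bochner_Integration.integral_sum)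
  also have "\<dots> \<le> (\<Sum>j=1..M. \<Sum>l\<in>cluster n j. (ln (real n) * mean_power + exp (- ln (real n))) / N0)"
  proof (intro sum_mono divide_right_mono)
    fix j l assume jl: "j \<in> {1..M}" "l \<in> cluster n j"
    show "expectation (\<lambda>\<omega>. h l l \<omega> * g (h l l \<omega>)) \<le> ln (real n) * mean_power + exp (- ln (real n))"
      using facts(5)[OF jl, of "ln (real n)"] assms by simp
  qed (use assms in auto)
  also have "\<dots> = real M / N0 * (real n * mean_power * ln (real n) + 1)"
    using assms by (simp add: card_cluster exp_minus field_simps)
  finally show ?thesis .
qed

end

text \<open>The policy may vary with \<open>n\<close>; a fixed one would make \<open>n\<close> times
  its mean power vanish or diverge. In the weak case \<open>\<alpha>\<close> is assumed positive:
  for \<open>\<alpha> = 0\<close> the interference vanishes whatever the policy, and full power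
  gives a sum-rate linear in \<open>n\<close>. In the moderate case positivity follows from the
  nonzero limit.\<close>

theorem theorem2:
  fixes M :: nat
    and W N0 \<alpha> \<beta>min \<beta>max varpi :: real
    and P :: "nat \<Rightarrow> 'a measure"
    and S :: "nat \<Rightarrow> nat \<Rightarrow> nat \<Rightarrow> 'a \<Rightarrow> bool"
    and \<beta> h L :: "nat \<Rightarrow> nat \<Rightarrow> nat \<Rightarrow> 'a \<Rightarrow> real"
    and g :: "nat \<Rightarrow> real \<Rightarrow> real"
    and i j :: "nat \<Rightarrow> nat"
  assumes "1 \<le> M" and "0 < W" and "0 < N0"
    and "\<And>n. 1 \<le> n \<Longrightarrow>
           clustered_network (P n) M n \<alpha> \<beta>min \<beta>max varpi (S n) (\<beta> n) (h n) (g n)"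
    and "\<And>n. 1 \<le> n \<Longrightarrow> L n = gain (S n) (\<beta> n) (h n)"
    (* i n is an arbitrary user of the n-th network and j n its cluster *)
    and "\<And>n. 1 \<le> n \<Longrightarrow> j n \<in> {1..M}"
    and "\<And>n. 1 \<le> n \<Longrightarrow> i n \<in> cluster n (j n)"
  shows "(lim_theta (\<lambda>n. \<integral>\<omega>. interference n (L n) (g n) (j n) (i n) \<omega> \<partial>P n) (\<lambda>_. 1) \<longrightarrow>
           (\<exists>B. lim_theta B (\<lambda>n. ln (real n)) \<and>
             (\<forall>n\<ge>1. avg_sum_rate (P n) M n W N0 (L n) (g n) \<le> B n))) \<and>
         (0 < \<alpha> \<and>
           (\<lambda>n. \<integral>\<omega>. interference n (L n) (g n) (j n) (i n) \<omega> \<partial>P n) \<in> o(\<lambda>_. 1) \<longrightarrow>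
           (\<exists>B. B \<in> o(\<lambda>n. ln (real n)) \<and>
             (\<forall>n\<ge>1. avg_sum_rate (P n) M n W N0 (L n) (g n) \<le> B n)))"
proof -
  define q where "q n = clustered_network.mean_power (g n)" for n
  define E where "E n = (\<integral>\<omega>. interference n (L n) (g n) (j n) (i n) \<omega> \<partial>P n)" for n
  let ?R = "\<lambda>n. avg_sum_rate (P n) M n W N0 (L n) (g n)"
  have E: "E n = (real n - 1) * (\<alpha> * varpi * q n)" if "1 \<le> n" for n
    using clustered_network.interference_mean[OF assms(4)[OF that] assms(6)[OF that] assms(7)[OF that]]
    by (simp add: E_def q_def assms(5)[OF that])
  have R: "?R n \<le> real M / N0 * (real n * q n * ln (real n) + 1)" if "1 \<le> n" for n
    using clustered_network.avg_sum_rate_le[OF assms(4)[OF that] assms(2,3) that]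
    by (simp add: q_def assms(5)[OF that])
  \<comment> \<open>The network with \<open>n = 2\<close> has users 1 and 2, hence a cross link,
    even when \<open>M = 1\<close>.\<close>
  have varpi: "0 < varpi"
    by (rule clustered_network.varpi_pos[OF assms(4)[of 2], of 1 2]) (use \<open>1 \<le> M\<close> in auto)
  \<comment> \<open>Solving \<open>E\<close> for the mean power gives \<open>n * q n\<close> as
    \<open>n / (n - 1)\<close> times \<open>E n / (\<alpha> * varpi)\<close>, valid from
    \<open>n = 2\<close> on.\<close>
  have lim: "(\<lambda>n. real n * q n) \<longlonglongrightarrow> c / (\<alpha> * varpi)" if "E \<longlonglongrightarrow> c" "0 < \<alpha>" for c
  proof -
    have "(\<lambda>n. real n / (real n - 1)) \<longlonglongrightarrow> 1"
      by real_asymp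
    from tendsto_mult[OF this tendsto_divide[OF that(1) tendsto_const, of "\<alpha> * varpi"]]
    have "(\<lambda>n. real n / (real n - 1) * (E n / (\<alpha> * varpi))) \<longlonglongrightarrow> c / (\<alpha> * varpi)"
      using that(2) varpi by simp
    moreover have "\<forall>\<^sub>F n in sequentially. real n / (real n - 1) * (E n / (\<alpha> * varpi)) = real n * q n"
      using eventually_ge_at_top[of 2]
    proof eventually_elim
      case (elim n)
      then show ?case
        using that(2) varpi by (simp add: E)
    qed
    ultimately show ?thesis
      by (rule Lim_transform_eventually)
  qed
  \<comment> \<open>Dividing the explicit bound by \<open>ln n\<close> turns its constant term into
    \<open>1 / ln n\<close>, which vanishes in the limit.\<close>
  have B: "(\<lambda>n. real M / N0 * (real n * q n * ln (real n) + 1) / ln (real n)) \<longlonglongrightarrow> real M / N0 * d"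
    if "(\<lambda>n. real n * q n) \<longlonglongrightarrow> d" for d
  proof -
    have "(\<lambda>n. 1 / ln (real n)) \<longlonglongrightarrow> 0"
      by real_asymp
    from tendsto_mult[OF tendsto_const tendsto_add[OF that this], of "real M / N0"]
    have "(\<lambda>n. real M / N0 * (real n * q n + 1 / ln (real n))) \<longlonglongrightarrow> real M / N0 * d"
      by simp
    moreover have "\<forall>\<^sub>F n in sequentially. real M / N0 * (real n * q n + 1 / ln (real n))
        = real M / N0 * (real n * q n * ln (real n) + 1) / ln (real n)"
      using eventually_ge_at_top[of 2]
    proof eventually_elim
      case (elim n)
      then have "ln (real n) \<noteq> 0" by simp
      then show ?case by (simp add: field_simps)
    qed
    ultimately show ?thesis
      by (rule Lim_transform_eventually)
  qed
  show ?thesis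
    unfolding E_def[symmetric]
  proof (intro conjI impI)
    assume "lim_theta E (\<lambda>_. 1)"
    then obtain c where c: "0 < c" "E \<longlonglongrightarrow> c"
      by (auto simp: lim_theta_def)
    \<comment> \<open>Without cross links the mean interference would be 0, against its positive
      limit.\<close>
    have "\<alpha> \<noteq> 0"
    proof
      assume z: "\<alpha> = 0"
      have "\<forall>\<^sub>F n in sequentially. E n = 0"
        using eventually_ge_at_top[of 1] by eventually_elim (simp add: E z)
      then have "E \<longlonglongrightarrow> 0"
        by (rule tendsto_eventually)
      then show False
        using LIMSEQ_unique[OF c(2)] c(1) by simp
    qed
    then have \<alpha>: "0 < \<alpha>"
      using clustered_network.alpha[OF assms(4)[of 1]] by simp
    have "lim_theta (\<lambda>n. real M / N0 * (real n * q n * ln (real n) + 1)) (\<lambda>n. ln (real n))"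
      unfolding lim_theta_def using B[OF lim[OF c(2) \<alpha>]] c(1) \<alpha> varpi assms(1,3)
      by (intro exI[of _ "real M / N0 * (c / (\<alpha> * varpi))"]) simp
    then show "\<exists>B. lim_theta B (\<lambda>n. ln (real n)) \<and> (\<forall>n\<ge>1. ?R n \<le> B n)"
      using R by blast
  next
    assume *: "0 < \<alpha> \<and> E \<in> o(\<lambda>_. 1)"
    then have "E \<longlonglongrightarrow> 0"
      by (auto dest!: smalloD_tendsto)
    \<comment> \<open>The same bound serves with \<open>c = 0\<close>: its ratio to
      \<open>ln n\<close> now tends to 0. From \<open>n = 2\<close> on the logarithm is
      nonzero.\<close>
    from B[OF lim[OF this]] *
    have "(\<lambda>n. real M / N0 * (real n * q n * ln (real n) + 1)) \<in> o(\<lambda>n. ln (real n))"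
      by (intro smalloI_tendsto) (auto intro: eventually_mono[OF eventually_ge_at_top[of 2]])
    then show "\<exists>B. B \<in> o(\<lambda>n. ln (real n)) \<and> (\<forall>n\<ge>1. ?R n \<le> B n)"
      using R by blast
  qed
qed

end
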